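(* Let ${\cal D}$ be a $K$-GDD$_\lambda$ of type $w^u$, and let $k_{\min}=\min\{k: k\in K\}$. Then \[\chi({\cal D})\le\left\lceil\frac{u}{k_{\min}-1}\right\rceil.\] Moreover, if $K=\{k\}$ and $k=u$, then $\chi({\cal D})=2$.
   Context: A $\lambda$-fold group divisible design $K$-GDD$_\lambda$ of type $w^u$ is a triple $(V,{\cal G},{\cal B})$ where ${\cal G}$ partitions the point set $V$ into $u$ groups each of size $w$, ${\cal B}$ is a collection of subsets (blocks) of $V$ with sizes in the set $K$ (all sizes at least $2$), no two points of the same group lie together in a block, and every pair of points from distinct groups lies in exactly $\lambda$ blocks. A weak $c$-colouring is a map from the points to a set of $c$ colours such that no block is monochromatic. The (weak) chromatic number $\chi({\cal D})$ is the least $c$ for which ${\cal D}$ has a weak $c$-colouring. *)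

theory Defs
  imports Complex_Main "HOL-Library.Multiset" "HOL-Library.FuncSet" "HOL-Library.Disjoint_Sets"
begin

(* Blocks form a multiset: for lam > 1 a block may be repeated, and pairs are
   counted with the multiplicity of the blocks containing them. *)
locale GDD =
  fixes V :: "'a set"
    and G :: "'a set set"
    and B :: "'a set multiset"
    and K :: "nat set"
    and lam w u :: nat
  assumes finite_points: "finite V"
    and groups_partition: "partition_on V G"
    and number_of_groups: "card G = u"
    and group_size: "\<And>g. g \<in> G \<Longrightarrow> card g = w"
    and sizes_nonempty: "K \<noteq> {}"
    and sizes_ge_2: "\<And>k. k \<in> K \<Longrightarrow> 2 \<le> k"
    and index_pos: "1 \<le> lam"
    and block_subset: "\<And>b. b \<in># B \<Longrightarrow> b \<subseteq> V"
    and block_size: "\<And>b. b \<in># B \<Longrightarrow> card b \<in> K"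
    and same_group: "\<And>b g x y. b \<in># B \<Longrightarrow> g \<in> G \<Longrightarrow> x \<in> g \<Longrightarrow> y \<in> g \<Longrightarrow> x \<noteq> y \<Longrightarrow>
                       \<not> (x \<in> b \<and> y \<in> b)"
    and distinct_groups: "\<And>g h x y. g \<in> G \<Longrightarrow> h \<in> G \<Longrightarrow> g \<noteq> h \<Longrightarrow> x \<in> g \<Longrightarrow> y \<in> h \<Longrightarrow>
                       size {#b \<in># B. x \<in> b \<and> y \<in> b#} = lam"

definition monochromatic :: "('a \<Rightarrow> 'c) \<Rightarrow> 'a set \<Rightarrow> bool" where
  "monochromatic f b \<longleftrightarrow> (\<exists>a. \<forall>x\<in>b. f x = a)"

definition weak_colouring :: "'a set \<Rightarrow> 'a set multiset \<Rightarrow> nat \<Rightarrow> ('a \<Rightarrow> nat) \<Rightarrow> bool" where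
  "weak_colouring V B c f \<longleftrightarrow> f \<in> V \<rightarrow> {..<c} \<and> (\<forall>b. b \<in># B \<longrightarrow> \<not> monochromatic f b)"

(* The least value is attained when V is finite and every block has at least two
   points, since an injective colouring is then weak. *)
definition chromatic_number :: "'a set \<Rightarrow> 'a set multiset \<Rightarrow> nat" where
  "chromatic_number V B = (LEAST c. \<exists>f. weak_colouring V B c f)"

end

theory Submission
  imports Defs
begin

text \<open>
  Let \<open>m = k\<^sub>m\<^sub>i\<^sub>n - 1\<close>, number the groups \<open>0, \<dots>, u - 1\<close>, and give all points of group
  \<open>i\<close> the colour \<open>i div m\<close>. A colour class consists of at most \<open>m\<close> groups, so a
  monochromatic block, having at most one point in each group, would have at most
  \<open>m < k\<^sub>m\<^sub>i\<^sub>n\<close> points. For \<open>K = {u}\<close> the bound is \<open>2\<close>, and it is sharp as there is a block.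
\<close>

lemma chromatic_number_le:
  assumes "weak_colouring V B c f"
  shows "chromatic_number V B \<le> c"
  unfolding chromatic_number_def using assms by (blast intro: Least_le)

text \<open>The given colouring shows that some number of colours is admissible, so the
  \<open>LEAST\<close> is attained.\<close>

lemma weak_colouring_chromatic_number:
  assumes "weak_colouring V B c f"
  shows "\<exists>f. weak_colouring V B (chromatic_number V B) f"
  unfolding chromatic_number_def
  by (rule LeastI[of "\<lambda>c. \<exists>f. weak_colouring V B c f" c]) (use assms in blast)

lemma two_le_if_weak_colouring:
  assumes col: "weak_colouring V B c f" and b: "b \<in># B" "b \<subseteq> V"
  shows "2 \<le> c"
proof (rule ccontr)
  assume c: "\<not> 2 \<le> c"
  \<comment> \<open>If \<open>c = 1\<close>, the only colour is 0. If \<open>c = 0\<close>, there is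
    no colour at all, so \<open>b\<close> is empty and the claim is vacuous.\<close>
  have "f x = 0" if "x \<in> b" for x
  proof -
    have "f x < c"
      using col b that by (auto simp: weak_colouring_def)
    then show ?thesis
      using c by simp
  qed
  then have "monochromatic f b"
    by (auto simp: monochromatic_def)
  with col b show False
    by (auto simp: weak_colouring_def)
qed

text \<open>An integer strictly below a real number is strictly below its ceiling. This keeps the
  colours in range even when \<open>m\<close> does not divide \<open>u\<close>.\<close>

lemma div_less_nat_ceiling:
  fixes i u m :: nat
  assumes "i < u" "0 < m"
  shows "i div m < nat \<lceil>real u / real m\<rceil>"
proof -
  have "real (i div m) \<le> real i / real m"
    by (rule of_nat_div_le_of_nat)
  also have "\<dots> < real u / real m"
    using assms by (simp add: divide_strict_right_mono)
  finally have "int (i div m) < \<lceil>real u / real m\<rceil>"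
    by (simp add: less_ceiling_iff)
  then show ?thesis
    by linarith
qed

text \<open>The fibre of \<open>q\<close> under division by \<open>m\<close> is an interval of
  length \<open>m\<close>.\<close>

lemma card_div_fibre_le:
  fixes m q :: nat
  assumes "0 < m" and "\<And>i. i \<in> A \<Longrightarrow> i div m = q"
  shows "card A \<le> m"
proof -
  have "A \<subseteq> {q * m..<q * m + m}"
  proof
    fix i assume "i \<in> A"
    then have "i = q * m + i mod m"
      using assms(2) div_mult_mod_eq[of i m] by simp
    moreover have "i mod m < m"
      using assms(1) by simp
    ultimately show "i \<in> {q * m..<q * m + m}"
      by (metis add_less_cancel_left atLeastLessThan_iff le_add1)
  qed
  then have "card A \<le> card {q * m..<q * m + m}"
    by (intro card_mono) auto
  then show ?thesis
    by simp
qed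

context GDD
begin

lemma finite_groups: "finite G"
  using finite_points groups_partition by (rule finite_elements)

text \<open>\<open>idx\<close> numbers the group of each point. Equal indices in a block would mean
  two points of one group, which \<open>same_group\<close> forbids unless they coincide.\<close>

lemma obtain_group_index:
  obtains idx where "idx \<in> V \<rightarrow> {..<u}" "\<And>b. b \<in># B \<Longrightarrow> inj_on idx b"
proof -
  obtain h where h: "bij_betw h G {0..<u}"
    using ex_bij_betw_finite_nat[OF finite_groups] number_of_groups by auto
  have "\<forall>x\<in>V. \<exists>g. g \<in> G \<and> x \<in> g"
    using groups_partition by (auto simp: partition_on_def)
  then obtain grp where grp: "\<And>x. x \<in> V \<Longrightarrow> grp x \<in> G \<and> x \<in> grp x"
    by metis
  have "(\<lambda>x. h (grp x)) \<in> V \<rightarrow> {..<u}"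
    using h grp by (auto simp: bij_betw_def)
  moreover have "inj_on (\<lambda>x. h (grp x)) b" if b: "b \<in># B" for b
  proof (rule inj_onI)
    fix x y assume xy: "x \<in> b" "y \<in> b" "h (grp x) = h (grp y)"
    then have V: "x \<in> V" "y \<in> V"
      using block_subset[OF b] by auto
    then have "grp x = grp y"
      using xy(3) h grp by (auto simp: bij_betw_def dest: inj_onD)
    then show "x = y"
      using same_group[OF b, of "grp x" x y] grp[OF V(1)] grp[OF V(2)] xy by auto
  qed
  ultimately show thesis
    by (rule that)
qed

lemma exists_weak_colouring:
  assumes "0 < m" "\<And>k. k \<in> K \<Longrightarrow> m < k"
  shows "\<exists>f. weak_colouring V B (nat \<lceil>real u / real m\<rceil>) f"
proof -
  obtain idx where idx: "idx \<in> V \<rightarrow> {..<u}" "\<And>b. b \<in># B \<Longrightarrow> inj_on idx b"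
    using obtain_group_index by blast
  have "\<not> monochromatic (\<lambda>x. idx x div m) b" if b: "b \<in># B" for b
  proof
    assume "monochromatic (\<lambda>x. idx x div m) b"
    then obtain q where "\<forall>x\<in>b. idx x div m = q"
      by (auto simp: monochromatic_def)
    \<comment> \<open>The fibre bound concerns group indices; injectivity of \<open>idx\<close> on
      \<open>b\<close> then carries it over to the points.\<close>
    then have "card (idx ` b) \<le> m"
      using assms(1) by (intro card_div_fibre_le) auto
    then have "card b \<le> m"
      by (simp add: card_image idx(2)[OF b])
    then show False
      using assms(2)[OF block_size[OF b]] by simp
  qed
  moreover have "(\<lambda>x. idx x div m) \<in> V \<rightarrow> {..<nat \<lceil>real u / real m\<rceil>}"
    using idx(1) assms(1) by (auto intro!: div_less_nat_ceiling)
  ultimately show ?thesis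
    unfolding weak_colouring_def by blast
qed

text \<open>Two distinct groups are nonempty, and a pair of points across them lies in
  \<open>lam\<close> \<ge> 1 blocks. The lower bound 2 rests on such a block.\<close>

lemma exists_block:
  assumes "2 \<le> u"
  obtains b where "b \<in># B"
proof -
  obtain g h where gh: "g \<in> G" "h \<in> G" "g \<noteq> h"
    using assms number_of_groups card_le_Suc0_iff_eq[OF finite_groups] by fastforce
  moreover have "{} \<notin> G"
    using groups_partition by (simp add: partition_on_def)
  ultimately obtain x y where "x \<in> g" "y \<in> h"
    by (metis all_not_in_conv)
  then have "size {#b \<in># B. x \<in> b \<and> y \<in> b#} = lam"
    using distinct_groups gh by blast
  then have "B \<noteq> {#}"
    using index_pos by auto
  then show thesis
    using that by blast
qed

end

theorem theorem3p3:
  fixes V :: "'a set" and G :: "'a set set" and B :: "'a set multiset"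
    and K :: "nat set" and lam w u :: nat
  assumes "GDD V G B K lam w u"
  shows "int (chromatic_number V B) \<le> \<lceil>real u / (real (LEAST k. k \<in> K) - 1)\<rceil>
       \<and> (\<forall>k. K = {k} \<and> k = u \<longrightarrow> chromatic_number V B = 2)"
proof -
  interpret GDD V G B K lam w u
    by (fact assms)
  \<comment> \<open>Block sizes are at least 2, so this subtraction on \<open>nat\<close> does not
    truncate and \<open>m\<close> is positive.\<close>
  define m where "m = (LEAST k. k \<in> K) - 1"
  have least: "(LEAST k. k \<in> K) \<in> K"
    using sizes_nonempty by (auto intro: LeastI)
  then have m: "0 < m" and real_m: "real (LEAST k. k \<in> K) - 1 = real m"
    using sizes_ge_2[OF least] by (auto simp: m_def)
  have m_less: "m < k" if "k \<in> K" for k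
    using Least_le[of "\<lambda>k. k \<in> K", OF that] m by (simp add: m_def)
  obtain f where f: "weak_colouring V B (nat \<lceil>real u / real m\<rceil>) f"
    using exists_weak_colouring[OF m m_less] by blast
  have bound: "chromatic_number V B \<le> nat \<lceil>real u / real m\<rceil>"
    using f by (rule chromatic_number_le)
  have "chromatic_number V B = 2" if K: "K = {u}"
  proof (rule antisym)
    have u: "2 \<le> u"
      using sizes_ge_2 K by simp
    have "m = u - 1"
      using least K by (simp add: m_def)
    \<comment> \<open>Here \<open>u / (u - 1)\<close> is at most 2 precisely because
      \<open>u\<close> is at least 2.\<close>
    then have "real u / real m \<le> 2"
      using u by (simp add: field_simps of_nat_diff)
    then have "\<lceil>real u / real m\<rceil> \<le> 2"
      by (simp add: ceiling_le_iff)
    then show "chromatic_number V B \<le> 2"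
      using bound by linarith
    obtain b where b: "b \<in># B"
      using exists_block[OF u] by blast
    show "2 \<le> chromatic_number V B"
      using weak_colouring_chromatic_number[OF f] two_le_if_weak_colouring b block_subset[OF b]
      by blast
  qed
  \<comment> \<open>Nonnegativity makes \<open>nat\<close> harmless, so the bound transfers to the
    integer ceiling.\<close>
  moreover have "0 \<le> real u / real m"
    by simp
  then have "int (chromatic_number V B) \<le> \<lceil>real u / real m\<rceil>"
    using bound by linarith
  ultimately show ?thesis
    using real_m by auto
qed

end
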